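(* Let $f$ be an internal map $A\subseteq\widetilde{\mathbb R}^d\to\widetilde{\mathbb R}^{d'}$ with $A$ and $f(A)$ sharply bounded. Let $A=[(A_\varepsilon)_\varepsilon]$. Then there exists a net $(f_\varepsilon)_\varepsilon$ with $f_\varepsilon\in\mathcal C^\infty(A_\varepsilon,\mathbb R^{d'})$ for all $\varepsilon\in(0,1)$ such that for each $\tilde x\in A$ and each representative $(x_\varepsilon)_\varepsilon$ of $\tilde x$ with $x_\varepsilon\in A_\varepsilon$ for all $\varepsilon$, $(f_\varepsilon(x_\varepsilon))_\varepsilon$ is a representative of $f(\tilde x)$. Further, $f$ is uniformly continuous (in the sharp topology), i.e. $$(\forall n\in\mathbb N)(\exists m\in\mathbb N)(\forall x,x'\in A)\ (|x-x'|\le\alpha^m\Rightarrow|f(x)-f(x')|\le\alpha^n).$$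
   Context: A net $(u_\varepsilon)_{\varepsilon\in(0,1)}$ in $\mathbb R^d$ is moderate if there are $M\in\mathbb N$ and $\eta\in(0,1)$ with $|u_\varepsilon|\le\varepsilon^{-M}$ for all $\varepsilon\le\eta$, and negligible if for each $m\in\mathbb N$ there is $\eta\in(0,1)$ with $|u_\varepsilon|\le\varepsilon^m$ for all $\varepsilon\le\eta$. $\widetilde{\mathbb R}$ is the ring of moderate nets in $\mathbb R$ modulo negligible nets, and $\widetilde{\mathbb R}^d$ is identified with the moderate nets in $\mathbb R^d$ modulo the negligible nets in $\mathbb R^d$; a net in the class $u$ is a representative of $u$. $|\cdot|:\widetilde{\mathbb R}^d\to\widetilde{\mathbb R}$ is defined by $|[(u_\varepsilon)_\varepsilon]|=[(|u_\varepsilon|)_\varepsilon]$. In $\widetilde{\mathbb R}$, $x\le y$ means that there are representatives with $x_\varepsilon\le y_\varepsilon$ for all sufficiently small $\varepsilon$. $\alpha\in\widetilde{\mathbb R}$ has representative $(\varepsilon)_\varepsilon$, $\alpha^m=[(\varepsilon^m)_\varepsilon]$. A subset $A\subseteq\widetilde{\mathbb R}^d$ is internal if there is a net $(A_\varepsilon)_{\varepsilon\in(0,1)}$ of subsets of $\mathbb R^d$ such that $A=[(A_\varepsilon)_\varepsilon]$, the set of all $u\in\widetilde{\mathbb R}^d$ for which there exist a representative $(u_\varepsilon)_\varepsilon$ of $u$ and $\eta>0$ with $u_\varepsilon\in A_\varepsilon$ for all $\varepsilon<\eta$. A subset $A\subseteq\widetilde{\mathbb R}^d$ is sharply bounded if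 there is $M\in\mathbb N$ with $|u|\le\alpha^{-M}$ for all $u\in A$. A map $f:A\subseteq\widetilde{\mathbb R}^d\to\widetilde{\mathbb R}^{d'}$ is internal if its graph $\{(x,f(x)):x\in A\}$ is an internal subset of $\widetilde{\mathbb R}^{d+d'}$. $\mathcal C^\infty(A_\varepsilon,\mathbb R^{d'})$ denotes the maps $A_\varepsilon\to\mathbb R^{d'}$ that are restrictions to $A_\varepsilon$ of $\mathcal C^\infty$-maps $\mathbb R^d\to\mathbb R^{d'}$. *)

theory Defs
  imports "HOL-Analysis.Analysis"
begin

section \<open>Moderate and negligible nets\<close>

text \<open>
  Nets indexed by \<open>(0,1)\<close> are functions on \<^typ>\<open>real\<close> of which only the values on \<open>{0<..<1}\<close>
  are ever used.  The space \<open>\<real>\<^sup>d\<close> is an arbitrary Euclidean space.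
\<close>

definition moderate :: "(real \<Rightarrow> 'a::real_normed_vector) \<Rightarrow> bool" where
  "moderate u \<longleftrightarrow>
    (\<exists>M::nat. \<exists>\<eta>\<in>{0<..<1}. \<forall>\<epsilon>\<in>{0<..\<eta>}. norm (u \<epsilon>) \<le> \<epsilon> powi (- int M))"

definition negligible_net :: "(real \<Rightarrow> 'a::real_normed_vector) \<Rightarrow> bool" where
  "negligible_net u \<longleftrightarrow>
    (\<forall>m::nat. \<exists>\<eta>\<in>{0<..<1}. \<forall>\<epsilon>\<in>{0<..\<eta>}. norm (u \<epsilon>) \<le> \<epsilon> ^ m)"

lemma negligible_net_mono:
  assumes "negligible_net u" "\<And>\<epsilon>. norm (v \<epsilon>) \<le> norm (u \<epsilon>)"
  shows "negligible_net v"
  using assms unfolding negligible_net_def by (meson order_trans)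

lemma moderate_mono:
  assumes "moderate u" "\<And>\<epsilon>. norm (v \<epsilon>) \<le> norm (u \<epsilon>)"
  shows "moderate v"
  using assms unfolding moderate_def by (meson order_trans)

lemma negligible_net_zero: "negligible_net (\<lambda>\<epsilon>. 0)"
  unfolding negligible_net_def by (intro allI bexI[of _ "1/2"]) auto

lemma moderate_zero: "moderate (\<lambda>\<epsilon>. 0)"
  unfolding moderate_def by (intro exI[of _ 0] bexI[of _ "1/2"]) auto

lemma negligible_net_minus: "negligible_net u \<Longrightarrow> negligible_net (\<lambda>\<epsilon>. - u \<epsilon>)"
  by (erule negligible_net_mono) simp

lemma moderate_minus: "moderate u \<Longrightarrow> moderate (\<lambda>\<epsilon>. - u \<epsilon>)"
  by (erule moderate_mono) simp

lemma negligible_net_add: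
  assumes "negligible_net u" "negligible_net v"
  shows "negligible_net (\<lambda>\<epsilon>. u \<epsilon> + v \<epsilon>)"
  unfolding negligible_net_def
proof
  fix m :: nat
  from assms(1) obtain a where a: "a \<in> {0<..<1}" "\<forall>\<epsilon>\<in>{0<..a}. norm (u \<epsilon>) \<le> \<epsilon> ^ Suc m"
    unfolding negligible_net_def by blast
  from assms(2) obtain b where b: "b \<in> {0<..<1}" "\<forall>\<epsilon>\<in>{0<..b}. norm (v \<epsilon>) \<le> \<epsilon> ^ Suc m"
    unfolding negligible_net_def by blast
  define c where "c = min (min a b) (1/2)"
  have "norm (u \<epsilon> + v \<epsilon>) \<le> \<epsilon> ^ m" if "\<epsilon> \<in> {0<..c}" for \<epsilon>
  proof -
    have "norm (u \<epsilon>) \<le> \<epsilon> * \<epsilon> ^ m" "norm (v \<epsilon>) \<le> \<epsilon> * \<epsilon> ^ m"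
      using a b that by (auto simp: c_def)
    moreover have "\<epsilon> * \<epsilon> ^ m \<le> (1/2) * \<epsilon> ^ m"
      using that by (intro mult_right_mono) (auto simp: c_def)
    ultimately show ?thesis
      using norm_triangle_ineq[of "u \<epsilon>" "v \<epsilon>"] by linarith
  qed
  moreover have "c \<in> {0<..<1}" using a b by (auto simp: c_def)
  ultimately show "\<exists>\<eta>\<in>{0<..<1}. \<forall>\<epsilon>\<in>{0<..\<eta>}. norm (u \<epsilon> + v \<epsilon>) \<le> \<epsilon> ^ m" by blast
qed

lemma moderate_add:
  assumes "moderate u" "moderate v"
  shows "moderate (\<lambda>\<epsilon>. u \<epsilon> + v \<epsilon>)"
proof -
  from assms(1) obtain a M where a: "a \<in> {0<..<1}"
    "\<forall>\<epsilon>\<in>{0<..a}. norm (u \<epsilon>) \<le> \<epsilon> powi (- int M)"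
    unfolding moderate_def by blast
  from assms(2) obtain b N where b: "b \<in> {0<..<1}"
    "\<forall>\<epsilon>\<in>{0<..b}. norm (v \<epsilon>) \<le> \<epsilon> powi (- int N)"
    unfolding moderate_def by blast
  define c where "c = min (min a b) (1/2)"
  define K where "K = max M N"
  have "norm (u \<epsilon> + v \<epsilon>) \<le> \<epsilon> powi (- int (Suc K))" if "\<epsilon> \<in> {0<..c}" for \<epsilon>
  proof -
    have e: "0 < \<epsilon>" "\<epsilon> \<le> 1/2" using that by (auto simp: c_def)
    have "norm (u \<epsilon>) \<le> \<epsilon> powi (- int M)" "norm (v \<epsilon>) \<le> \<epsilon> powi (- int N)"
      using a b that by (auto simp: c_def)
    moreover have "inverse \<epsilon> ^ M \<le> inverse \<epsilon> ^ K" "inverse \<epsilon> ^ N \<le> inverse \<epsilon> ^ K"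
      using e by (auto intro!: power_increasing simp: K_def one_le_inverse)
    moreover have "2 * inverse \<epsilon> ^ K \<le> inverse \<epsilon> * inverse \<epsilon> ^ K"
      using e by (intro mult_right_mono) (auto simp: field_simps)
    ultimately show ?thesis
      using norm_triangle_ineq[of "u \<epsilon>" "v \<epsilon>"]
      by (simp add: power_int_minus power_inverse flip: of_nat_Suc)
  qed
  moreover have "c \<in> {0<..<1}" using a b by (auto simp: c_def)
  ultimately show ?thesis unfolding moderate_def by blast
qed

definition net_eq :: "(real \<Rightarrow> 'a::real_normed_vector) \<Rightarrow> (real \<Rightarrow> 'a) \<Rightarrow> bool" where
  "net_eq u v \<longleftrightarrow> moderate u \<and> moderate v \<and> negligible_net (\<lambda>\<epsilon>. u \<epsilon> - v \<epsilon>)"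

lemma part_equivp_net_eq: "part_equivp net_eq"
proof (rule part_equivpI)
  show "\<exists>u. net_eq u (u :: real \<Rightarrow> 'a)"
    by (rule exI[of _ "\<lambda>_. 0"]) (simp add: net_eq_def moderate_zero negligible_net_zero)
  show "symp (net_eq :: (real \<Rightarrow> 'a) \<Rightarrow> _)"
    by (rule sympI) (auto simp: net_eq_def dest: negligible_net_minus)
  show "transp (net_eq :: (real \<Rightarrow> 'a) \<Rightarrow> _)"
  proof (rule transpI)
    fix u v w :: "real \<Rightarrow> 'a"
    assume "net_eq u v" "net_eq v w"
    then show "net_eq u w"
      using negligible_net_add[of "\<lambda>\<epsilon>. u \<epsilon> - v \<epsilon>" "\<lambda>\<epsilon>. v \<epsilon> - w \<epsilon>"] by (simp add: net_eq_def)
  qed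
qed

section \<open>Generalized points\<close>

text \<open>
  For \<open>'a = \<real>\<^sup>d\<close> the type \<open>'a gen\<close> consists of the generalized points (moderate nets in
  \<open>\<real>\<^sup>d\<close> modulo negligible ones); \<open>real gen\<close> consists of the generalized numbers.  The
  quotient is partial: only moderate nets have a class.
\<close>

quotient_type (overloaded) 'a gen = "real \<Rightarrow> 'a::real_normed_vector" / partial: net_eq
  morphisms rep_gen gclass
  by (rule part_equivp_net_eq)

text \<open>
  The conjunct \<open>moderate u\<close> is needed since \<^const>\<open>gclass\<close> is unspecified on nets that
  are not moderate.
\<close>

definition represents :: "(real \<Rightarrow> 'a::real_normed_vector) \<Rightarrow> 'a gen \<Rightarrow> bool" where
  "represents u x \<longleftrightarrow> moderate u \<and> gclass u = x"

lemma represents_iff_net_eq: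
  assumes "represents u x"
  shows "represents v x \<longleftrightarrow> net_eq u v"
  using assms Quotient_rel[OF Quotient_gen, of u v]
  by (auto simp: represents_def net_eq_def negligible_net_zero)

lemma ex_represents: "\<exists>u. represents u x"
  using Quotient_rep_reflp[OF Quotient_gen, of x] Quotient_abs_rep[OF Quotient_gen, of x]
  by (auto simp: represents_def net_eq_def)

instantiation gen :: (real_normed_vector) ab_group_add
begin

lift_definition zero_gen :: "'a gen" is "\<lambda>\<epsilon>. 0"
  by (simp add: net_eq_def moderate_zero negligible_net_zero)

lift_definition plus_gen :: "'a gen \<Rightarrow> 'a gen \<Rightarrow> 'a gen" is "\<lambda>u v \<epsilon>. u \<epsilon> + v \<epsilon>"
  unfolding net_eq_def
  by (auto intro: moderate_add simp: add_diff_add dest: negligible_net_add)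

lift_definition uminus_gen :: "'a gen \<Rightarrow> 'a gen" is "\<lambda>u \<epsilon>. - u \<epsilon>"
  unfolding net_eq_def
  by (auto intro: moderate_minus dest: negligible_net_minus)

lift_definition minus_gen :: "'a gen \<Rightarrow> 'a gen \<Rightarrow> 'a gen" is "\<lambda>u v \<epsilon>. u \<epsilon> - v \<epsilon>"
proof -
  fix u u' v v' :: "real \<Rightarrow> 'a"
  assume "net_eq u u'" "net_eq v v'"
  then show "net_eq (\<lambda>\<epsilon>. u \<epsilon> - v \<epsilon>) (\<lambda>\<epsilon>. u' \<epsilon> - v' \<epsilon>)"
    using moderate_add[of u "\<lambda>\<epsilon>. - v \<epsilon>"] moderate_add[of u' "\<lambda>\<epsilon>. - v' \<epsilon>"]
      negligible_net_add[of "\<lambda>\<epsilon>. u \<epsilon> - u' \<epsilon>" "\<lambda>\<epsilon>. - (v \<epsilon> - v' \<epsilon>)"]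
      moderate_minus[of v] moderate_minus[of v'] negligible_net_minus[of "\<lambda>\<epsilon>. v \<epsilon> - v' \<epsilon>"]
    by (auto simp: net_eq_def algebra_simps)
qed

instance
proof
  fix a b c :: "'a gen"
  show "a + b + c = a + (b + c)"
    by transfer (auto simp: net_eq_def negligible_net_zero add.assoc intro!: moderate_add)
  show "a + b = b + a"
    by transfer (auto simp: net_eq_def negligible_net_zero add.commute intro!: moderate_add)
  show "0 + a = a"
    by transfer (auto simp: net_eq_def negligible_net_zero)
  show "- a + a = 0"
    by transfer (auto simp: net_eq_def negligible_net_zero moderate_zero)
  show "a - b = a + - b"
    by transfer (auto simp: net_eq_def negligible_net_zero
        dest: moderate_minus intro!: moderate_add[where v = "\<lambda>\<epsilon>. - _ \<epsilon>", simplified])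
qed

end

lift_definition gnorm :: "'a::real_normed_vector gen \<Rightarrow> real gen" is "\<lambda>u \<epsilon>. norm (u \<epsilon>)"
  unfolding net_eq_def
  by (auto elim: moderate_mono elim!: negligible_net_mono simp: norm_triangle_ineq3)

definition gen_le :: "real gen \<Rightarrow> real gen \<Rightarrow> bool"  (infix "\<le>\<^sub>g" 50) where
  "x \<le>\<^sub>g y \<longleftrightarrow> (\<exists>u v. represents u x \<and> represents v y \<and>
    (\<exists>\<eta>\<in>{0<..<1}. \<forall>\<epsilon>\<in>{0<..\<eta>}. u \<epsilon> \<le> v \<epsilon>))"

text \<open>\<open>alpha_pow k\<close> is \<open>\<alpha>\<^sup>k\<close>, with negative exponents allowed.\<close>

definition alpha_pow :: "int \<Rightarrow> real gen" where
  "alpha_pow k = gclass (\<lambda>\<epsilon>. \<epsilon> powi k)"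

lemma represents_alpha_pow: "represents (\<lambda>\<epsilon>. \<epsilon> powi k) (alpha_pow k)"
proof -
  have "\<epsilon> powi k \<le> \<epsilon> powi (- int (nat \<bar>k\<bar>))" if "\<epsilon> \<in> {0<..1/2}" for \<epsilon> :: real
    using that by (intro power_int_decreasing) auto
  then have "moderate (\<lambda>\<epsilon>::real. \<epsilon> powi k)"
    unfolding moderate_def
    by (intro exI[of _ "nat \<bar>k\<bar>"] bexI[of _ "1/2"]) auto
  then show ?thesis by (simp add: represents_def alpha_pow_def)
qed

section \<open>Internal sets and maps\<close>

definition internal_set :: "(real \<Rightarrow> 'a::euclidean_space set) \<Rightarrow> 'a gen set" where
  "internal_set A = {x. \<exists>u. represents u x \<and>
    (\<exists>\<eta>>0. \<forall>\<epsilon>\<in>{0<..<1}. \<epsilon> < \<eta> \<longrightarrow> u \<epsilon> \<in> A \<epsilon>)}"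

definition internal :: "'a::euclidean_space gen set \<Rightarrow> bool" where
  "internal S \<longleftrightarrow> (\<exists>A. S = internal_set A)"

definition sharply_bounded :: "'a::euclidean_space gen set \<Rightarrow> bool" where
  "sharply_bounded S \<longleftrightarrow> (\<exists>M::nat. \<forall>x\<in>S. gnorm x \<le>\<^sub>g alpha_pow (- int M))"

text \<open>
  \<open>\<real>\<^bsup>d+d'\<^esup>\<close> is rendered as the Euclidean space \<open>\<real>\<^sup>d \<times> \<real>\<^bsup>d'\<^esup>\<close>, and \<open>gpair\<close> identifies a pair of
  generalized points with a generalized point of this product.
\<close>

lift_definition gpair ::
    "'a::euclidean_space gen \<Rightarrow> 'b::euclidean_space gen \<Rightarrow> ('a \<times> 'b) gen"
  is "\<lambda>u v \<epsilon>. (u \<epsilon>, v \<epsilon>)"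
proof -
  fix u u' :: "real \<Rightarrow> 'a" and v v' :: "real \<Rightarrow> 'b"
  assume *: "net_eq u u'" "net_eq v v'"
  have mod: "moderate (\<lambda>\<epsilon>. (p \<epsilon>, q \<epsilon>))" if "moderate p" "moderate q"
    for p :: "real \<Rightarrow> 'a" and q :: "real \<Rightarrow> 'b"
    using moderate_add[OF moderate_mono[OF that(1), of "\<lambda>\<epsilon>. (p \<epsilon>, 0::'b)"]
        moderate_mono[OF that(2), of "\<lambda>\<epsilon>. (0::'a, q \<epsilon>)"]] by (simp add: norm_Pair)
  have neg: "negligible_net (\<lambda>\<epsilon>. (p \<epsilon>, q \<epsilon>))" if "negligible_net p" "negligible_net q"
    for p :: "real \<Rightarrow> 'a" and q :: "real \<Rightarrow> 'b"
    using negligible_net_add[OF negligible_net_mono[OF that(1), of "\<lambda>\<epsilon>. (p \<epsilon>, 0::'b)"]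
        negligible_net_mono[OF that(2), of "\<lambda>\<epsilon>. (0::'a, q \<epsilon>)"]] by (simp add: norm_Pair)
  show "net_eq (\<lambda>\<epsilon>. (u \<epsilon>, v \<epsilon>)) (\<lambda>\<epsilon>. (u' \<epsilon>, v' \<epsilon>))"
    using * by (auto simp: net_eq_def intro: mod neg)
qed

text \<open>Only the values of \<open>f\<close> on \<open>S\<close> matter: \<open>f\<close> stands for a map defined on \<open>S\<close>.\<close>

definition internal_map ::
    "'a::euclidean_space gen set \<Rightarrow> ('a gen \<Rightarrow> 'b::euclidean_space gen) \<Rightarrow> bool" where
  "internal_map S f \<longleftrightarrow> internal ((\<lambda>x. gpair x (f x)) ` S)"

section \<open>Smooth maps\<close>

text \<open>
  In finite dimension the derivative is of class \<open>C\<^sup>k\<close> iff all its directional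
  evaluations are.
\<close>

fun Ck_map :: "nat \<Rightarrow> ('a::euclidean_space \<Rightarrow> 'b::euclidean_space) \<Rightarrow> bool" where
  "Ck_map 0 f \<longleftrightarrow> continuous_on UNIV f"
| "Ck_map (Suc k) f \<longleftrightarrow> (\<forall>x. f differentiable (at x)) \<and>
    (\<forall>v. Ck_map k (\<lambda>x. frechet_derivative f (at x) v))"

definition smooth_map :: "('a::euclidean_space \<Rightarrow> 'b::euclidean_space) \<Rightarrow> bool" where
  "smooth_map f \<longleftrightarrow> (\<forall>k. Ck_map k f)"

text \<open>\<open>smooth_on_set S f\<close>: the restriction of \<open>f\<close> to \<open>S\<close> belongs to \<open>C\<^sup>\<infinity>(S, \<real>\<^bsup>d'\<^esup>)\<close>.\<close>

definition smooth_on_set ::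
    "'a::euclidean_space set \<Rightarrow> ('a \<Rightarrow> 'b::euclidean_space) \<Rightarrow> bool" where
  "smooth_on_set S f \<longleftrightarrow> (\<exists>g. smooth_map g \<and> (\<forall>x\<in>S. f x = g x))"

end

theory Submission
  imports Defs
begin

text \<open>
  The idea is saturation.  A statement about single points of the sets of a net that
  fails for arbitrarily small \<open>\<epsilon>\<close> can be turned into one generalized point: take the failing
  points where they exist and arbitrary points elsewhere.  Hence properties of an internal set
  or map can be read off, uniformly for small \<open>\<epsilon>\<close>, from the sets that define it.

  Let \<open>[G\<^sub>\<epsilon>]\<close> be the graph of \<open>f\<close>.  As \<open>A\<close> and \<open>f ` A\<close> are sharply bounded, the parts \<open>D\<^sub>\<epsilon>\<close> of
  \<open>A\<^sub>\<epsilon>\<close> and \<open>H\<^sub>\<epsilon>\<close> of \<open>G\<^sub>\<epsilon>\<close> within a radius that is a fixed negative power of \<open>\<epsilon>\<close> define the same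
  internal sets, and now every choice of points from them is moderate, so that it does define a
  generalized point.  Saturation then gives two facts.  Since \<open>f\<close> is single-valued, the relations
  \<open>H\<^sub>\<epsilon>\<close> are uniformly continuous on polynomial scales: points at distance \<open>\<epsilon>\<^sup>m\<close> have values at
  distance \<open>\<epsilon>\<^sup>n\<close> (\<open>functional_net_uniformly_continuous\<close>); this yields the sharp uniform
  continuity of \<open>f\<close>.  Since \<open>f\<close> is defined on all of \<open>A\<close>, every point of \<open>D\<^sub>\<epsilon>\<close> is within \<open>\<epsilon>\<^sup>m\<close> of the domain
  of \<open>H\<^sub>\<epsilon>\<close>, for every \<open>m\<close> (\<open>netwise_dense_imp_uniformly_dense\<close>).

  For fixed \<open>\<epsilon>\<close> and fixed precision, the values of finitely many points of \<open>H\<^sub>\<epsilon>\<close> are averaged with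
  a partition of unity, and the average is replaced by a polynomial by Stone--Weierstrass
  (\<open>polynomial_approximate_selection\<close>), which is smooth on the whole space.
  Each precision \<open>\<epsilon>\<^sup>k\<close> is attained for all small \<open>\<epsilon>\<close>, so choosing for each \<open>\<epsilon>\<close> a smooth map that
  attains the best possible \<open>k \<le> 1/\<epsilon>\<close> yields one net that attains all of them
  (\<open>smooth_net_near_relation\<close>).  By uniform continuity, the values of this net at a representative
  of a point of \<open>A\<close> differ from those of the graph by a negligible net.
\<close>

section \<open>Nets and their classes\<close>

text \<open>
  All notions for nets say that something holds for all sufficiently small \<open>\<epsilon>\<close>.  Written with the
  filter \<^term>\<open>at_right (0::real)\<close>, such statements combine without bookkeeping of thresholds.
\<close>

lemma eventually_at_right_0_iff:
  "(\<forall>\<^sub>F \<epsilon> in at_right (0::real). P \<epsilon>) \<longleftrightarrow> (\<exists>\<eta>\<in>{0<..<1}. \<forall>\<epsilon>\<in>{0<..\<eta>}. P \<epsilon>)"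
proof
  assume "\<forall>\<^sub>F \<epsilon> in at_right 0. P \<epsilon>"
  then obtain b :: real where b: "b > 0" "\<And>y. 0 < y \<Longrightarrow> y < b \<Longrightarrow> P y"
    by (auto simp: eventually_at_right_field)
  then have "\<forall>\<epsilon>\<in>{0<..min (b/2) (1/2)}. P \<epsilon>" by auto
  then show "\<exists>\<eta>\<in>{0<..<1}. \<forall>\<epsilon>\<in>{0<..\<eta>}. P \<epsilon>"
    using b(1) by (intro bexI[of _ "min (b/2) (1/2)"]) auto
next
  assume "\<exists>\<eta>\<in>{0<..<1}. \<forall>\<epsilon>\<in>{0<..\<eta>}. P \<epsilon>"
  then show "\<forall>\<^sub>F \<epsilon> in at_right 0. P \<epsilon>"
    unfolding eventually_at_right_field by (metis greaterThanAtMost_iff greaterThanLessThan_iff less_eq_real_def)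
qed

lemma eventually_small:
  fixes c :: real assumes "c > 0" shows "\<forall>\<^sub>F \<epsilon> in at_right 0. 0 < \<epsilon> \<and> \<epsilon> \<le> c"
  unfolding eventually_at_right_field using assms by (intro exI[of _ c]) auto

lemma moderate_iff:
  "moderate u \<longleftrightarrow> (\<exists>M::nat. \<forall>\<^sub>F \<epsilon> in at_right 0. norm (u \<epsilon>) \<le> \<epsilon> powi (- int M))"
  by (simp add: moderate_def eventually_at_right_0_iff)

lemma negligible_net_iff:
  "negligible_net u \<longleftrightarrow> (\<forall>m::nat. \<forall>\<^sub>F \<epsilon> in at_right 0. norm (u \<epsilon>) \<le> \<epsilon> ^ m)"
  by (simp add: negligible_net_def eventually_at_right_0_iff)

lemma gen_le_iff:
  "x \<le>\<^sub>g y \<longleftrightarrow> (\<exists>u v. represents u x \<and> represents v y \<and> (\<forall>\<^sub>F \<epsilon> in at_right 0. u \<epsilon> \<le> v \<epsilon>))"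
  by (simp add: gen_le_def eventually_at_right_0_iff)

lemma mem_internal_set_iff:
  "x \<in> internal_set A \<longleftrightarrow> (\<exists>u. represents u x \<and> (\<forall>\<^sub>F \<epsilon> in at_right 0. u \<epsilon> \<in> A \<epsilon>))"
proof -
  have "(\<exists>\<eta>>0. \<forall>\<epsilon>\<in>{0<..<1}. \<epsilon> < \<eta> \<longrightarrow> u \<epsilon> \<in> A \<epsilon>) \<longleftrightarrow> (\<forall>\<^sub>F \<epsilon> in at_right 0. u \<epsilon> \<in> A \<epsilon>)"
    (is "?L \<longleftrightarrow> ?R") for u
  proof
    assume ?L
    then obtain \<eta> where "\<eta> > 0" "\<forall>\<epsilon>\<in>{0<..<1}. \<epsilon> < \<eta> \<longrightarrow> u \<epsilon> \<in> A \<epsilon>" by blast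
    then show ?R
      unfolding eventually_at_right_field by (intro exI[of _ "min 1 \<eta>"]) auto
  next
    assume ?R
    then show ?L unfolding eventually_at_right_field by auto
  qed
  then show ?thesis by (simp add: internal_set_def)
qed

lemma negligible_net_imp_moderate: "negligible_net u \<Longrightarrow> moderate u"
  unfolding moderate_iff negligible_net_iff by (rule exI[of _ 0]) (auto dest: spec[of _ 0])

lemma represents_gclass: "moderate u \<Longrightarrow> represents u (gclass u)"
  by (simp add: represents_def)

lemma represents_same:
  assumes "represents u x" "represents v x"
  shows "\<forall>\<^sub>F \<epsilon> in at_right 0. norm (u \<epsilon> - v \<epsilon>) \<le> \<epsilon> ^ m"
  using assms(2) unfolding represents_iff_net_eq[OF assms(1)] net_eq_def negligible_net_iff by blast

lemma represents_cong:
  assumes "represents u x" "negligible_net (\<lambda>\<epsilon>. u \<epsilon> - v \<epsilon>)"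
  shows "represents v x"
proof -
  have "moderate u" using assms(1) by (simp add: represents_def)
  then have "moderate (\<lambda>\<epsilon>. u \<epsilon> + - (u \<epsilon> - v \<epsilon>))"
    using moderate_add[OF _ moderate_minus[OF negligible_net_imp_moderate[OF assms(2)]]] by blast
  then show ?thesis
    using \<open>moderate u\<close> assms(2) unfolding represents_iff_net_eq[OF assms(1)] net_eq_def by simp
qed

lemma represents_unique: "represents u x \<Longrightarrow> represents u y \<Longrightarrow> x = y"
  by (simp add: represents_def)

lemma represents_diff:
  assumes "represents u x" "represents v y"
  shows "represents (\<lambda>\<epsilon>. u \<epsilon> - v \<epsilon>) (x - y)"
proof -
  have m: "moderate u" "moderate v" "gclass u = x" "gclass v = y" using assms by (auto simp: represents_def)
  have "net_eq u u" "net_eq v v" using m by (auto simp: net_eq_def negligible_net_zero)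
  then have "gclass u - gclass v = gclass (\<lambda>\<epsilon>. u \<epsilon> - v \<epsilon>)"
    by (rule minus_gen.abs_eq)
  moreover have "moderate (\<lambda>\<epsilon>. u \<epsilon> - v \<epsilon>)"
    using moderate_add[OF m(1) moderate_minus[OF m(2)]] by simp
  ultimately show ?thesis using m by (simp add: represents_def)
qed

lemma represents_gnorm:
  assumes "represents u x"
  shows "represents (\<lambda>\<epsilon>. norm (u \<epsilon>)) (gnorm x)"
proof -
  have m: "moderate u" "gclass u = x" using assms by (auto simp: represents_def)
  have "net_eq u u" using m by (auto simp: net_eq_def negligible_net_zero)
  then have "gnorm (gclass u) = gclass (\<lambda>\<epsilon>. norm (u \<epsilon>))"
    by (rule gnorm.abs_eq)
  moreover have "moderate (\<lambda>\<epsilon>. norm (u \<epsilon>))"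
    by (rule moderate_mono[OF m(1)]) simp
  ultimately show ?thesis using m by (simp add: represents_def)
qed

lemma represents_gpair:
  assumes "represents u x" "represents v y"
  shows "represents (\<lambda>\<epsilon>. (u \<epsilon>, v \<epsilon>)) (gpair x y)"
proof -
  have m: "moderate u" "moderate v" "gclass u = x" "gclass v = y"
    using assms by (auto simp: represents_def)
  have "net_eq u u" "net_eq v v" using m by (auto simp: net_eq_def negligible_net_zero)
  then have "gpair (gclass u) (gclass v) = gclass (\<lambda>\<epsilon>. (u \<epsilon>, v \<epsilon>))"
    by (rule gpair.abs_eq)
  moreover have "moderate (\<lambda>\<epsilon>. (u \<epsilon>, v \<epsilon>))"
    using moderate_add[OF moderate_mono[OF m(1), of "\<lambda>\<epsilon>. (u \<epsilon>, 0)"]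
        moderate_mono[OF m(2), of "\<lambda>\<epsilon>. (0, v \<epsilon>)"]] by (simp add: norm_Pair)
  ultimately show ?thesis using m by (simp add: represents_def)
qed

lemma represents_gpairD:
  assumes "represents w (gpair x y)"
  shows "represents (\<lambda>\<epsilon>. fst (w \<epsilon>)) x" "represents (\<lambda>\<epsilon>. snd (w \<epsilon>)) y"
proof -
  obtain u v where uv: "represents u x" "represents v y" using ex_represents by metis
  have neg: "negligible_net (\<lambda>\<epsilon>. (u \<epsilon>, v \<epsilon>) - w \<epsilon>)"
    using assms unfolding represents_iff_net_eq[OF represents_gpair[OF uv]] net_eq_def by blast
  have "negligible_net (\<lambda>\<epsilon>. u \<epsilon> - fst (w \<epsilon>))"
    by (rule negligible_net_mono[OF neg]) (metis fst_conv fst_diff norm_fst_le surjective_pairing)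
  then show "represents (\<lambda>\<epsilon>. fst (w \<epsilon>)) x" by (rule represents_cong[OF uv(1)])
  have "negligible_net (\<lambda>\<epsilon>. v \<epsilon> - snd (w \<epsilon>))"
    by (rule negligible_net_mono[OF neg]) (metis snd_conv snd_diff norm_snd_le surjective_pairing)
  then show "represents (\<lambda>\<epsilon>. snd (w \<epsilon>)) y" by (rule represents_cong[OF uv(2)])
qed

text \<open>
  A bound for a class holds for each of its representatives at the price of one power of \<open>\<epsilon>\<close>: the
  negligible errors are at most \<open>\<epsilon> powi k\<close> each, and \<open>3 * \<epsilon> \<le> 1\<close> for small \<open>\<epsilon>\<close>.
\<close>

lemma gnorm_le_alpha_powD:
  assumes "gnorm x \<le>\<^sub>g alpha_pow k" "represents u x"
  shows "\<forall>\<^sub>F \<epsilon> in at_right 0. norm (u \<epsilon>) \<le> \<epsilon> powi (k - 1)"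
proof -
  obtain p q where pq: "represents p (gnorm x)" "represents q (alpha_pow k)"
    "\<forall>\<^sub>F \<epsilon> in at_right 0. p \<epsilon> \<le> q \<epsilon>"
    using assms(1) unfolding gen_le_iff by blast
  define m where "m = nat \<bar>k\<bar>"
  show ?thesis
    using pq(3) represents_same[OF represents_gnorm[OF assms(2)] pq(1), of m]
      represents_same[OF pq(2) represents_alpha_pow, of m] eventually_small[of "1/3", simplified]
  proof eventually_elim
    case (elim \<epsilon>)
    have e: "0 < \<epsilon>" "\<epsilon> \<le> 1/3" using elim by auto
    have "\<epsilon> ^ m = \<epsilon> powi (int m)" by simp
    also have "\<dots> \<le> \<epsilon> powi k" using e by (intro power_int_decreasing) (auto simp: m_def)
    finally have "norm (u \<epsilon>) \<le> 3 * \<epsilon> powi k" using elim by auto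
    also have "\<epsilon> powi k = \<epsilon> * \<epsilon> powi (k - 1)"
      using e by (simp add: power_int_diff)
    also have "3 * (\<epsilon> * \<epsilon> powi (k - 1)) \<le> 1 * \<epsilon> powi (k - 1)"
      unfolding mult.assoc[symmetric] using e by (intro mult_right_mono) auto
    finally show ?case by simp
  qed
qed

lemma gnorm_le_alpha_powI:
  assumes "represents u x" "\<forall>\<^sub>F \<epsilon> in at_right 0. norm (u \<epsilon>) \<le> \<epsilon> powi k"
  shows "gnorm x \<le>\<^sub>g alpha_pow k"
  unfolding gen_le_iff using represents_gnorm[OF assms(1)] represents_alpha_pow assms(2) by blast

lemma moderateI:
  "\<forall>\<^sub>F \<epsilon> in at_right 0. norm (u \<epsilon>) \<le> \<epsilon> powi (- int N) \<Longrightarrow> moderate u"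
  by (auto simp: moderate_iff)

lemma sharply_bounded_representatives:
  assumes "sharply_bounded S"
  obtains N :: nat where "\<And>x u. x \<in> S \<Longrightarrow> represents u x \<Longrightarrow>
    \<forall>\<^sub>F \<epsilon> in at_right 0. norm (u \<epsilon>) \<le> \<epsilon> powi (- int N)"
proof -
  obtain M :: nat where M: "\<And>x. x \<in> S \<Longrightarrow> gnorm x \<le>\<^sub>g alpha_pow (- int M)"
    using assms by (auto simp: sharply_bounded_def)
  have "- int M - 1 = - int (Suc M)" by simp
  then show ?thesis
    using gnorm_le_alpha_powD[OF M] by (intro that[of "Suc M"]) (simp only:)
qed

section \<open>Saturation\<close>

text \<open>
  If each of countably many properties holds for arbitrarily small \<open>\<epsilon>\<close>, pick \<open>s\<^sub>k \<le> 1/(k+1)\<close> with the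
  \<open>k\<close>-th one.  On \<open>E = {s\<^sub>0, s\<^sub>1, \<dots>}\<close> the index \<open>\<kappa>\<close> of a property that holds tends to infinity,
  because only finitely many \<open>s\<^sub>k\<close> have small \<open>k\<close> and they are all positive.
\<close>

lemma frequently_diagonal:
  fixes P :: "nat \<Rightarrow> real \<Rightarrow> bool"
  assumes "\<And>k. \<exists>\<^sub>F \<epsilon> in at_right 0. P k \<epsilon>"
  obtains E \<kappa> where "\<exists>\<^sub>F \<epsilon> in at_right 0. \<epsilon> \<in> E" "\<And>\<epsilon>. \<epsilon> \<in> E \<Longrightarrow> P (\<kappa> \<epsilon>) \<epsilon>"
    "\<And>K. \<forall>\<^sub>F \<epsilon> in at_right 0. \<epsilon> \<in> E \<longrightarrow> K \<le> \<kappa> \<epsilon>"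
proof -
  have "\<exists>\<epsilon>. 0 < \<epsilon> \<and> \<epsilon> \<le> inverse (real (Suc k)) \<and> P k \<epsilon>" for k
    using frequently_ex[OF frequently_eventually_conj[OF assms[of k] eventually_small[of "inverse (real (Suc k))"]]]
    by auto
  then obtain s where s: "\<And>k. 0 < s k" "\<And>k. s k \<le> inverse (real (Suc k))" "\<And>k. P k (s k)"
    by metis
  define \<kappa> where "\<kappa> \<epsilon> = (SOME k. s k = \<epsilon>)" for \<epsilon>
  have \<kappa>: "s (\<kappa> \<epsilon>) = \<epsilon>" if "\<epsilon> \<in> range s" for \<epsilon>
    using that by (auto simp: \<kappa>_def intro: someI)
  show ?thesis
  proof (rule that)
    show "\<exists>\<^sub>F \<epsilon> in at_right 0. \<epsilon> \<in> range s"
      unfolding frequently_def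
    proof
      assume "\<forall>\<^sub>F \<epsilon> in at_right 0. \<epsilon> \<notin> range s"
      then obtain b where "b > 0" "\<And>y. 0 < y \<Longrightarrow> y < b \<Longrightarrow> y \<notin> range s"
        by (auto simp: eventually_at_right_field)
      moreover obtain k where "inverse (real (Suc k)) < b"
        using reals_Archimedean[OF \<open>b > 0\<close>] by blast
      ultimately show False using s(1,2)[of k] by force
    qed
    show "P (\<kappa> \<epsilon>) \<epsilon>" if "\<epsilon> \<in> range s" for \<epsilon>
      using s(3)[of "\<kappa> \<epsilon>"] \<kappa>[OF that] by simp
    show "\<forall>\<^sub>F \<epsilon> in at_right 0. \<epsilon> \<in> range s \<longrightarrow> K \<le> \<kappa> \<epsilon>" for K
    proof -
      have "\<forall>\<^sub>F \<epsilon> in at_right 0. \<epsilon> \<le> s j / 2" for j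
        using eventually_small[of "s j / 2"] s(1)[of j] by (auto elim: eventually_mono)
      then have "\<forall>\<^sub>F \<epsilon> in at_right 0. \<forall>j\<in>{..<K}. \<epsilon> \<le> s j / 2"
        by (intro eventually_ball_finite) auto
      then show ?thesis
      proof eventually_elim
        case (elim \<epsilon>)
        show ?case
        proof (intro impI leI notI)
          assume "\<epsilon> \<in> range s" "\<kappa> \<epsilon> < K"
          then have "\<epsilon> \<le> \<epsilon> / 2" using elim \<kappa>[of \<epsilon>] by force
          then show False using \<open>\<epsilon> \<in> range s\<close> s(1) by force
        qed
      qed
    qed
  qed
qed

text \<open>
  Saturation for single-valued relations.  If no power \<open>\<epsilon>\<^sup>m\<close> works for \<open>\<epsilon>\<^sup>n\<close>, the diagonal argument
  gives pairs of points of \<open>H\<^sub>\<epsilon>\<close>, for \<open>\<epsilon>\<close> in a set \<open>E\<close> accumulating at \<open>0\<close>, whose first components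
  are closer than any power of \<open>\<epsilon>\<close> while the second ones stay \<open>\<epsilon>\<^sup>n\<close> apart.  Completed off \<open>E\<close> by
  equal points, these pairs form two nets that contradict the hypothesis.
\<close>

lemma functional_net_uniformly_continuous:
  fixes H :: "real \<Rightarrow> ('a::real_normed_vector \<times> 'b::real_normed_vector) set"
  assumes ne: "\<forall>\<^sub>F \<epsilon> in at_right 0. H \<epsilon> \<noteq> {}"
    and functional: "\<And>w w'. \<lbrakk>\<forall>\<^sub>F \<epsilon> in at_right 0. w \<epsilon> \<in> H \<epsilon>; \<forall>\<^sub>F \<epsilon> in at_right 0. w' \<epsilon> \<in> H \<epsilon>;
        negligible_net (\<lambda>\<epsilon>. fst (w \<epsilon>) - fst (w' \<epsilon>))\<rbrakk>
      \<Longrightarrow> negligible_net (\<lambda>\<epsilon>. snd (w \<epsilon>) - snd (w' \<epsilon>))"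
  shows "\<exists>m. \<forall>\<^sub>F \<epsilon> in at_right 0. \<forall>p\<in>H \<epsilon>. \<forall>p'\<in>H \<epsilon>.
    norm (fst p - fst p') \<le> \<epsilon> ^ m \<longrightarrow> norm (snd p - snd p') \<le> \<epsilon> ^ n"
proof (rule ccontr)
  define bad where "bad k \<epsilon> p p' \<longleftrightarrow> p \<in> H \<epsilon> \<and> p' \<in> H \<epsilon> \<and>
    norm (fst p - fst p') \<le> \<epsilon> ^ k \<and> \<not> norm (snd p - snd p') \<le> \<epsilon> ^ n" for k \<epsilon> p p'
  assume no_modulus: "\<not> ?thesis"
  have often: "\<exists>\<^sub>F \<epsilon> in at_right 0. \<exists>p p'. bad k \<epsilon> p p'" for k
  proof (rule ccontr)
    assume "\<not> (\<exists>\<^sub>F \<epsilon> in at_right 0. \<exists>p p'. bad k \<epsilon> p p')"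
    then have "\<forall>\<^sub>F \<epsilon> in at_right 0. \<forall>p p'. \<not> bad k \<epsilon> p p'"
      by (simp add: not_frequently)
    then have "\<forall>\<^sub>F \<epsilon> in at_right 0. \<forall>p\<in>H \<epsilon>. \<forall>p'\<in>H \<epsilon>.
        norm (fst p - fst p') \<le> \<epsilon> ^ k \<longrightarrow> norm (snd p - snd p') \<le> \<epsilon> ^ n"
      by (rule eventually_mono) (simp add: bad_def)
    with no_modulus show False by blast
  qed
  obtain E \<kappa> where E: "\<exists>\<^sub>F \<epsilon> in at_right 0. \<epsilon> \<in> E"
    "\<And>\<epsilon>. \<epsilon> \<in> E \<Longrightarrow> \<exists>p p'. bad (\<kappa> \<epsilon>) \<epsilon> p p'"
    "\<And>K. \<forall>\<^sub>F \<epsilon> in at_right 0. \<epsilon> \<in> E \<longrightarrow> K \<le> \<kappa> \<epsilon>"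
    by (rule frequently_diagonal[where P = "\<lambda>k \<epsilon>. \<exists>p p'. bad k \<epsilon> p p'", OF often]) blast
  obtain q q' where q: "\<And>\<epsilon>. \<epsilon> \<in> E \<Longrightarrow> bad (\<kappa> \<epsilon>) \<epsilon> (q \<epsilon>) (q' \<epsilon>)"
    using E(2) by metis
  define w where "w \<epsilon> = (if \<epsilon> \<in> E then q \<epsilon> else (SOME p. p \<in> H \<epsilon>))" for \<epsilon>
  define w' where "w' \<epsilon> = (if \<epsilon> \<in> E then q' \<epsilon> else (SOME p. p \<in> H \<epsilon>))" for \<epsilon>
  have "\<forall>\<^sub>F \<epsilon> in at_right 0. w \<epsilon> \<in> H \<epsilon>" "\<forall>\<^sub>F \<epsilon> in at_right 0. w' \<epsilon> \<in> H \<epsilon>"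
    using ne by (eventually_elim, use q in \<open>auto simp: w_def w'_def bad_def some_in_eq\<close>)+
  moreover have "negligible_net (\<lambda>\<epsilon>. fst (w \<epsilon>) - fst (w' \<epsilon>))"
    unfolding negligible_net_iff
  proof
    fix K
    show "\<forall>\<^sub>F \<epsilon> in at_right 0. norm (fst (w \<epsilon>) - fst (w' \<epsilon>)) \<le> \<epsilon> ^ K"
      using E(3)[of K] eventually_small[of 1, simplified]
    proof eventually_elim
      case (elim \<epsilon>)
      show ?case
      proof (cases "\<epsilon> \<in> E")
        case True
        then have "norm (fst (w \<epsilon>) - fst (w' \<epsilon>)) \<le> \<epsilon> ^ \<kappa> \<epsilon>"
          using q by (simp add: w_def w'_def bad_def)
        also have "\<dots> \<le> \<epsilon> ^ K" using elim True by (intro power_decreasing) auto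
        finally show ?thesis .
      next
        case False
        then show ?thesis using elim by (simp add: w_def w'_def)
      qed
    qed
  qed
  ultimately have "negligible_net (\<lambda>\<epsilon>. snd (w \<epsilon>) - snd (w' \<epsilon>))" by (rule functional)
  then have "\<forall>\<^sub>F \<epsilon> in at_right 0. norm (snd (w \<epsilon>) - snd (w' \<epsilon>)) \<le> \<epsilon> ^ n"
    by (simp add: negligible_net_iff)
  with E(1) have "\<exists>\<^sub>F \<epsilon> in at_right 0. norm (snd (w \<epsilon>) - snd (w' \<epsilon>)) \<le> \<epsilon> ^ n \<and> \<epsilon> \<in> E"
    by (rule frequently_eventually_conj)
  then obtain \<epsilon> where "\<epsilon> \<in> E" "norm (snd (w \<epsilon>) - snd (w' \<epsilon>)) \<le> \<epsilon> ^ n"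
    by (auto dest: frequently_ex)
  then show False using q[of \<epsilon>] by (simp add: w_def w'_def bad_def)
qed

text \<open>
  Saturation for density: the net \<open>u\<close> below picks a point of \<open>D\<^sub>\<epsilon>\<close> far from \<open>C\<^sub>\<epsilon>\<close> whenever there is
  one, so that the hypothesis for this single net excludes such points for small \<open>\<epsilon>\<close>.
\<close>

lemma netwise_dense_imp_uniformly_dense:
  fixes C D :: "real \<Rightarrow> 'a::real_normed_vector set"
  assumes ne: "\<forall>\<^sub>F \<epsilon> in at_right 0. D \<epsilon> \<noteq> {}"
    and netwise: "\<And>u. \<forall>\<^sub>F \<epsilon> in at_right 0. u \<epsilon> \<in> D \<epsilon> \<Longrightarrow>
      \<exists>c. (\<forall>\<^sub>F \<epsilon> in at_right 0. c \<epsilon> \<in> C \<epsilon>) \<and> negligible_net (\<lambda>\<epsilon>. u \<epsilon> - c \<epsilon>)"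
  shows "\<forall>\<^sub>F \<epsilon> in at_right 0. \<forall>a\<in>D \<epsilon>. \<exists>c\<in>C \<epsilon>. norm (a - c) \<le> \<epsilon> ^ m"
proof -
  define far where "far \<epsilon> a \<longleftrightarrow> (\<forall>c\<in>C \<epsilon>. \<not> norm (a - c) \<le> \<epsilon> ^ m)" for \<epsilon> a
  define u where "u \<epsilon> = (if \<exists>a\<in>D \<epsilon>. far \<epsilon> a then SOME a. a \<in> D \<epsilon> \<and> far \<epsilon> a else SOME a. a \<in> D \<epsilon>)" for \<epsilon>
  have far: "u \<epsilon> \<in> D \<epsilon> \<and> far \<epsilon> (u \<epsilon>)" if "\<exists>a\<in>D \<epsilon>. far \<epsilon> a" for \<epsilon>
    using that someI_ex[of "\<lambda>a. a \<in> D \<epsilon> \<and> far \<epsilon> a"] by (auto simp: u_def)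
  have "\<forall>\<^sub>F \<epsilon> in at_right 0. u \<epsilon> \<in> D \<epsilon>"
    using ne
  proof eventually_elim
    case (elim \<epsilon>)
    then show ?case
      using far[of \<epsilon>] by (cases "\<exists>a\<in>D \<epsilon>. far \<epsilon> a") (simp_all add: u_def some_in_eq)
  qed
  then obtain c where c: "\<forall>\<^sub>F \<epsilon> in at_right 0. c \<epsilon> \<in> C \<epsilon>" "negligible_net (\<lambda>\<epsilon>. u \<epsilon> - c \<epsilon>)"
    using netwise by blast
  from c(2) have "\<forall>\<^sub>F \<epsilon> in at_right 0. norm (u \<epsilon> - c \<epsilon>) \<le> \<epsilon> ^ m"
    by (simp add: negligible_net_iff)
  with c(1) show ?thesis
    by eventually_elim (use far in \<open>auto simp: far_def\<close>)
qed

section \<open>Polynomial approximation of relations\<close>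

text \<open>
  Polynomials are smooth because their directional derivatives are again polynomials; this closure
  property is what the induction over the order of differentiability needs.
\<close>

lemma real_polynomial_function_has_derivative:
  assumes "real_polynomial_function p"
  shows "\<exists>p'. (\<forall>x. (p has_derivative p' x) (at x)) \<and> (\<forall>v. real_polynomial_function (\<lambda>x. p' x v))"
  using assms
proof (induction rule: real_polynomial_function.induct)
  case (linear h)
  then show ?case
    by (intro exI[of _ "\<lambda>_. h"])
      (simp add: bounded_linear_imp_has_derivative real_polynomial_function.intros)
next
  case (const c)
  then show ?case
    by (intro exI[of _ "\<lambda>_ _. 0"]) (simp add: real_polynomial_function.intros)
next
  case (add f g)
  then obtain f' g' where
    "\<And>x. (f has_derivative f' x) (at x)" "\<And>v. real_polynomial_function (\<lambda>x. f' x v)"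
    "\<And>x. (g has_derivative g' x) (at x)" "\<And>v. real_polynomial_function (\<lambda>x. g' x v)"
    by metis
  then show ?case
    by (intro exI[of _ "\<lambda>x v. f' x v + g' x v"] conjI allI
        has_derivative_add real_polynomial_function.intros(3))
next
  case (mult f g)
  then obtain f' g' where
    "\<And>x. (f has_derivative f' x) (at x)" "\<And>v. real_polynomial_function (\<lambda>x. f' x v)"
    "\<And>x. (g has_derivative g' x) (at x)" "\<And>v. real_polynomial_function (\<lambda>x. g' x v)"
    by metis
  with mult.hyps show ?case
    by (intro exI[of _ "\<lambda>x v. f x * g' x v + f' x v * g x"] conjI allI
        has_derivative_mult real_polynomial_function.intros(3,4))
qed

lemma polynomial_function_frechet_derivative:
  fixes p :: "'a::euclidean_space \<Rightarrow> 'b::euclidean_space"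
  assumes "polynomial_function p"
  shows "p differentiable (at x)" "polynomial_function (\<lambda>x. frechet_derivative p (at x) v)"
proof -
  have "\<forall>b\<in>Basis. \<exists>q'. (\<forall>x. ((\<lambda>y. p y \<bullet> b) has_derivative q' x) (at x)) \<and>
      (\<forall>v. real_polynomial_function (\<lambda>x. q' x v))"
    using assms polynomial_function_iff_Basis_inner real_polynomial_function_has_derivative by blast
  then obtain q' where q': "\<And>b x. b \<in> Basis \<Longrightarrow> ((\<lambda>y. p y \<bullet> b) has_derivative q' b x) (at x)"
      "\<And>b v. b \<in> Basis \<Longrightarrow> real_polynomial_function (\<lambda>x. q' b x v)"
    by metis
  define p' where "p' x v = (\<Sum>b\<in>Basis. q' b x v *\<^sub>R b)" for x v
  have p'b: "p' x v \<bullet> b = q' b x v" if "b \<in> Basis" for x v b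
    using that by (simp add: p'_def inner_sum_left inner_Basis if_distrib sum.delta cong: if_cong)
  have der: "(p has_derivative p' x) (at x)" for x
    using q'(1) by (subst has_derivative_componentwise_within) (simp add: p'b)
  then show "p differentiable (at x)" by (auto simp: differentiable_def)
  have "frechet_derivative p (at x) = p' x" for x
    using der frechet_derivative_at by metis
  then show "polynomial_function (\<lambda>x. frechet_derivative p (at x) v)"
    unfolding polynomial_function_iff_Basis_inner using q'(2) by (simp add: p'b)
qed

lemma smooth_map_polynomial_function:
  fixes p :: "'a::euclidean_space \<Rightarrow> 'b::euclidean_space"
  assumes "polynomial_function p"
  shows "smooth_map p"
proof -
  have "Ck_map k p" for k
    using assms
  proof (induction k arbitrary: p)
    case 0
    then show ?case by (simp add: continuous_on_polymonial_function)
  next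
    case (Suc k)
    then show ?case by (simp add: polynomial_function_frechet_derivative)
  qed
  then show ?thesis by (simp add: smooth_map_def)
qed

text \<open>
  A relation \<open>G\<close> with oscillation at most \<open>\<tau>\<close> on the scale \<open>4 * \<delta>\<close>, whose domain is \<open>\<delta>\<close>-dense in \<open>S\<close>,
  is followed by a polynomial.  The supports of tent functions of radius \<open>2 * \<delta>\<close> around finitely many
  points of the domain cover the compact closure of \<open>S\<close>; at each point only values belonging to domain points within
  \<open>4 * \<delta>\<close> of each other are averaged.  One \<open>\<tau>\<close> is spent on the averaging and one on
  Stone--Weierstrass.
\<close>

lemma polynomial_approximate_selection:
  fixes G :: "('a::euclidean_space \<times> 'b::euclidean_space) set"
  assumes S: "bounded S" and pos: "\<delta> > 0" "\<tau> > 0"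
    and dense: "\<And>a. a \<in> S \<Longrightarrow> \<exists>(a', b')\<in>G. norm (a - a') \<le> \<delta>"
    and osc: "\<And>a b a' b'. (a, b) \<in> G \<Longrightarrow> (a', b') \<in> G \<Longrightarrow> norm (a - a') \<le> 4 * \<delta>
      \<Longrightarrow> norm (b - b') \<le> \<tau>"
  shows "\<exists>p. polynomial_function p \<and>
    (\<forall>a\<in>S. \<exists>(a', b')\<in>G. norm (a - a') \<le> 2 * \<delta> \<and> norm (p a - b') \<le> 2 * \<tau>)"
proof -
  define K where "K = closure S"
  have K: "compact K" using S by (simp add: K_def)
  have cover: "K \<subseteq> (\<Union>g\<in>G. ball (fst g) (2 * \<delta>))"
  proof
    fix x assume "x \<in> K"
    then obtain a where a: "a \<in> S" "dist a x < \<delta>"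
      using pos(1) by (auto simp: K_def closure_approachable)
    with dense obtain a' b' where g: "(a', b') \<in> G" "norm (a - a') \<le> \<delta>" by blast
    have "dist a' x < 2 * \<delta>"
      using a(2) g(2) dist_triangle[of a' x a] by (simp add: dist_norm norm_minus_commute)
    with g(1) show "x \<in> (\<Union>g\<in>G. ball (fst g) (2 * \<delta>))" by force
  qed
  obtain F where F: "F \<subseteq> G" "finite F" "K \<subseteq> (\<Union>g\<in>F. ball (fst g) (2 * \<delta>))"
    using compactE_image[OF K _ cover] by (metis open_ball)
  \<comment> \<open>\<open>h\<close> averages the values of \<open>F\<close> with the normalized tent functions \<open>w g\<close>.\<close>
  define w where "w g x = max 0 (2 * \<delta> - dist (fst g) x)" for g :: "'a \<times> 'b" and x
  define W where "W x = (\<Sum>g\<in>F. w g x)" for x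
  define h where "h x = (1 / W x) *\<^sub>R (\<Sum>g\<in>F. w g x *\<^sub>R snd g)" for x
  have w0: "w g x \<ge> 0" for g x by (simp add: w_def)
  have active: "\<exists>g\<in>F. w g x > 0" if "x \<in> K" for x
    using F(3) that by (force simp: w_def)
  have Wpos: "W x > 0" if "x \<in> K" for x
    unfolding W_def using active[OF that] w0 F(2) by (metis sum_pos2)
  have cont: "continuous_on K h"
    unfolding h_def W_def w_def
    using Wpos by (intro continuous_intros) (auto simp: W_def w_def less_le)
  then obtain p where p: "polynomial_function p" "\<And>x. x \<in> K \<Longrightarrow> norm (h x - p x) < \<tau>"
    using Stone_Weierstrass_polynomial_function[OF K cont pos(2)] by blast
  have "\<exists>(a', b')\<in>G. norm (a - a') \<le> 2 * \<delta> \<and> norm (p a - b') \<le> 2 * \<tau>" if "a \<in> S" for a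
  proof -
    have aK: "a \<in> K" using that closure_subset by (auto simp: K_def)
    obtain g0 where g0: "g0 \<in> F" "w g0 a > 0" using active[OF aK] by blast
    have near: "norm (w g a *\<^sub>R (snd g - snd g0)) \<le> w g a * \<tau>" if "g \<in> F" for g
    proof (cases "w g a > 0")
      case True
      have "norm (fst g - fst g0) \<le> 4 * \<delta>"
        using True g0(2) dist_triangle2[of "fst g" "fst g0" a]
        by (simp add: w_def dist_norm max_def split: if_splits)
      moreover have "(fst g, snd g) \<in> G" "(fst g0, snd g0) \<in> G" using that g0(1) F(1) by auto
      ultimately have "norm (snd g - snd g0) \<le> \<tau>" using osc by blast
      then show ?thesis using w0[of g a] by (simp add: mult_left_mono)
    next
      case False
      then show ?thesis using w0[of g a] by simp
    qed
    have "h a - snd g0 = (1 / W a) *\<^sub>R (\<Sum>g\<in>F. w g a *\<^sub>R (snd g - snd g0))"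
      using Wpos[OF aK]
      by (simp add: h_def scaleR_diff_right sum_subtractf W_def flip: scaleR_sum_left)
    also have "norm \<dots> \<le> (1 / W a) * (\<Sum>g\<in>F. w g a * \<tau>)"
      using Wpos[OF aK] sum_norm_le[of F, OF near] by (simp add: divide_right_mono)
    also have "\<dots> = \<tau>"
      using Wpos[OF aK] by (simp add: W_def flip: sum_distrib_right)
    finally have "norm (h a - snd g0) \<le> \<tau>" .
    then have "norm (p a - snd g0) \<le> 2 * \<tau>"
      using p(2)[OF aK] norm_triangle_ineq[of "p a - h a" "h a - snd g0"]
      by (simp add: norm_minus_commute)
    moreover have "norm (a - fst g0) \<le> 2 * \<delta>"
      using g0(2) by (simp add: w_def dist_norm norm_minus_commute max_def split: if_splits)
    moreover have "(fst g0, snd g0) \<in> G" using g0(1) F(1) by auto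
    ultimately show ?thesis by blast
  qed
  with p(1) show ?thesis by blast
qed

section \<open>Smooth nets close to a net of relations\<close>

text \<open>
  A larger index is a stronger requirement, so an element that meets the largest satisfiable
  requirement up to \<open>N\<close> meets all the satisfiable ones.
\<close>

lemma ex_best_below:
  fixes R :: "nat \<Rightarrow> 'c \<Rightarrow> bool"
  assumes "S \<noteq> {}" and antimono: "\<And>k l f. k \<le> l \<Longrightarrow> R l f \<Longrightarrow> R k f"
  shows "\<exists>f\<in>S. \<forall>k\<le>N. (\<exists>g\<in>S. R k g) \<longrightarrow> R k f"
proof (induction N)
  case 0
  then show ?case using assms(1) by auto
next
  case (Suc N)
  show ?case
  proof (cases "\<exists>g\<in>S. R (Suc N) g")
    case True
    then show ?thesis using antimono by blast
  next
    case False
    then show ?thesis using Suc by (auto simp: le_Suc_eq)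
  qed
qed

text \<open>
  For fixed \<open>k\<close> and small \<open>\<epsilon>\<close>, the polynomial approximation with \<open>\<delta> = \<epsilon>\<^sup>l\<close>, \<open>l\<close> large, and
  \<open>\<tau> = \<epsilon>\<^bsup>k+1\<^esup>\<close> follows \<open>H\<^sub>\<epsilon>\<close> with precision \<open>\<epsilon>\<^sup>k\<close>.  The best choice among the precisions
  \<open>k \<le> 1/\<epsilon>\<close> does so for all \<open>k\<close> simultaneously.
\<close>

lemma smooth_net_near_relation:
  fixes H :: "real \<Rightarrow> ('a::euclidean_space \<times> 'b::euclidean_space) set"
  assumes bdd: "\<And>\<epsilon>. bounded (D \<epsilon>)"
    and cont: "\<And>n. \<exists>m. \<forall>\<^sub>F \<epsilon> in at_right 0. \<forall>p\<in>H \<epsilon>. \<forall>p'\<in>H \<epsilon>.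
      norm (fst p - fst p') \<le> \<epsilon> ^ m \<longrightarrow> norm (snd p - snd p') \<le> \<epsilon> ^ n"
    and dense: "\<And>m. \<forall>\<^sub>F \<epsilon> in at_right 0. \<forall>a\<in>D \<epsilon>. \<exists>c\<in>fst ` H \<epsilon>. norm (a - c) \<le> \<epsilon> ^ m"
  shows "\<exists>F. (\<forall>\<epsilon>. smooth_map (F \<epsilon>)) \<and> (\<forall>k. \<forall>\<^sub>F \<epsilon> in at_right 0. \<forall>a\<in>D \<epsilon>. \<exists>p\<in>H \<epsilon>.
    norm (a - fst p) \<le> \<epsilon> ^ k \<and> norm (F \<epsilon> a - snd p) \<le> \<epsilon> ^ k)"
proof -
  \<comment> \<open>The guard on \<open>\<epsilon>\<close> makes precision \<open>l\<close> imply precision \<open>k \<le> l\<close> for all real \<open>\<epsilon>\<close>.\<close>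
  define R where "R \<epsilon> k f \<longleftrightarrow> (0 < \<epsilon> \<and> \<epsilon> \<le> 1 \<longrightarrow> (\<forall>a\<in>D \<epsilon>. \<exists>p\<in>H \<epsilon>.
    norm (a - fst p) \<le> \<epsilon> ^ k \<and> norm (f a - snd p) \<le> \<epsilon> ^ k))" for \<epsilon> k f
  have antimono: "R \<epsilon> k f" if "k \<le> l" "R \<epsilon> l f" for \<epsilon> k l f
    using that power_decreasing[OF that(1), of \<epsilon>] unfolding R_def by (meson less_imp_le order_trans)
  have level: "\<forall>\<^sub>F \<epsilon> in at_right 0. \<exists>g. smooth_map g \<and> R \<epsilon> k g" for k
  proof -
    obtain m where m: "\<forall>\<^sub>F \<epsilon> in at_right 0. \<forall>p\<in>H \<epsilon>. \<forall>p'\<in>H \<epsilon>.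
      norm (fst p - fst p') \<le> \<epsilon> ^ m \<longrightarrow> norm (snd p - snd p') \<le> \<epsilon> ^ Suc k"
      using cont by blast
    \<comment> \<open>The successor absorbs the factor \<open>4\<close>, as \<open>4 * \<epsilon> \<le> 1\<close>.\<close>
    define l where "l = Suc (max m k)"
    show ?thesis
      using m dense[of l] eventually_small[of "1/4", simplified]
    proof eventually_elim
      case (elim \<epsilon>)
      have e: "0 < \<epsilon>" "\<epsilon> \<le> 1/4" using elim(3) by auto
      have "4 * \<epsilon> ^ l \<le> \<epsilon> ^ max m k"
        using e by (simp add: l_def mult_left_le_one_le)
      moreover have "\<epsilon> ^ max m k \<le> \<epsilon> ^ m" "\<epsilon> ^ max m k \<le> \<epsilon> ^ k"
        using e by (auto intro: power_decreasing)
      ultimately have l: "4 * \<epsilon> ^ l \<le> \<epsilon> ^ m" "4 * \<epsilon> ^ l \<le> \<epsilon> ^ k" by auto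
      have "\<exists>p. polynomial_function p \<and> (\<forall>a\<in>D \<epsilon>. \<exists>(a', b')\<in>H \<epsilon>.
          norm (a - a') \<le> 2 * \<epsilon> ^ l \<and> norm (p a - b') \<le> 2 * \<epsilon> ^ Suc k)"
      proof (rule polynomial_approximate_selection)
        show "\<exists>(a', b')\<in>H \<epsilon>. norm (a - a') \<le> \<epsilon> ^ l" if "a \<in> D \<epsilon>" for a
          using elim(2) that by force
        show "norm (b - b') \<le> \<epsilon> ^ Suc k"
          if "(a, b) \<in> H \<epsilon>" "(a', b') \<in> H \<epsilon>" "norm (a - a') \<le> 4 * \<epsilon> ^ l" for a b a' b'
          using elim(1) that l(1) by force
      qed (use bdd e in auto)
      then obtain p where p: "polynomial_function p" "\<forall>a\<in>D \<epsilon>. \<exists>(a', b')\<in>H \<epsilon>.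
          norm (a - a') \<le> 2 * \<epsilon> ^ l \<and> norm (p a - b') \<le> 2 * \<epsilon> ^ Suc k" by blast
      have "2 * \<epsilon> ^ l \<le> \<epsilon> ^ k" using l(2) e zero_less_power[of \<epsilon> l] by linarith
      moreover have "2 * \<epsilon> ^ Suc k \<le> \<epsilon> ^ k"
        using e by (simp add: mult_left_le_one_le)
      ultimately have "\<exists>q\<in>H \<epsilon>. norm (a - fst q) \<le> \<epsilon> ^ k \<and> norm (p a - snd q) \<le> \<epsilon> ^ k"
        if "a \<in> D \<epsilon>" for a
        using p(2)[rule_format, OF that] by (auto intro!: bexI)
      then have "R \<epsilon> k p" by (simp add: R_def)
      then show ?case using p(1) smooth_map_polynomial_function by blast
    qed
  qed
  define N where "N \<epsilon> = nat \<lfloor>1 / \<epsilon>\<rfloor>" for \<epsilon> :: real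
  have "(\<lambda>_. 0) \<in> {f :: 'a \<Rightarrow> 'b. smooth_map f}"
    by (simp add: smooth_map_polynomial_function)
  then have "\<exists>f\<in>{f. smooth_map f}. \<forall>k\<le>N \<epsilon>. (\<exists>g\<in>{f. smooth_map f}. R \<epsilon> k g) \<longrightarrow> R \<epsilon> k f" for \<epsilon>
    using antimono by (intro ex_best_below) auto
  then obtain F where F: "\<And>\<epsilon>. smooth_map (F \<epsilon>)"
    "\<And>\<epsilon> k g. k \<le> N \<epsilon> \<Longrightarrow> smooth_map g \<Longrightarrow> R \<epsilon> k g \<Longrightarrow> R \<epsilon> k (F \<epsilon>)"
    unfolding Bex_def mem_Collect_eq by metis
  have "\<forall>\<^sub>F \<epsilon> in at_right 0. \<forall>a\<in>D \<epsilon>. \<exists>p\<in>H \<epsilon>.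
    norm (a - fst p) \<le> \<epsilon> ^ k \<and> norm (F \<epsilon> a - snd p) \<le> \<epsilon> ^ k" for k
    using level[of k] eventually_small[of "1 / Suc k", simplified]
  proof eventually_elim
    case (elim \<epsilon>)
    have "real k \<le> 1 / \<epsilon>" using elim by (simp add: field_simps)
    then have "k \<le> N \<epsilon>" unfolding N_def by linarith
    then have "R \<epsilon> k (F \<epsilon>)" using F(2) elim by blast
    moreover have "\<epsilon> \<le> 1" using elim(2) by (auto elim: order_trans)
    ultimately show ?case using elim by (simp add: R_def)
  qed
  with F(1) show ?thesis by blast
qed

section \<open>Internal maps are given by nets of smooth maps\<close>

theorem theorem4p4:
  fixes A :: "'a::euclidean_space gen set"
    and f :: "'a gen \<Rightarrow> 'b::euclidean_space gen"
    and A_net :: "real \<Rightarrow> 'a set"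
  assumes "internal_map A f"
    and "sharply_bounded A"
    and "sharply_bounded (f ` A)"
    and "A = internal_set A_net"
  shows "(\<exists>f_net :: real \<Rightarrow> 'a \<Rightarrow> 'b.
            (\<forall>\<epsilon>\<in>{0<..<1}. smooth_on_set (A_net \<epsilon>) (f_net \<epsilon>)) \<and>
            (\<forall>x\<in>A. \<forall>u. represents u x \<and> (\<forall>\<epsilon>\<in>{0<..<1}. u \<epsilon> \<in> A_net \<epsilon>) \<longrightarrow>
               represents (\<lambda>\<epsilon>. f_net \<epsilon> (u \<epsilon>)) (f x)))
         \<and> (\<forall>n::nat. \<exists>m::nat. \<forall>x\<in>A. \<forall>x'\<in>A.
              gnorm (x - x') \<le>\<^sub>g alpha_pow (int m) \<longrightarrow>
              gnorm (f x - f x') \<le>\<^sub>g alpha_pow (int n))"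
proof (cases "A = {}")
  case True
  have "smooth_on_set S (\<lambda>_ :: 'a. 0 :: 'b)" for S
    unfolding smooth_on_set_def
    by (rule exI[of _ "\<lambda>_. 0"]) (simp add: smooth_map_polynomial_function)
  with True show ?thesis by (intro conjI exI[of _ "\<lambda>_ _. 0"]) auto
next
  case False
  obtain G where G: "(\<lambda>x. gpair x (f x)) ` A = internal_set G"
    using assms(1) by (auto simp: internal_map_def internal_def)
  obtain N where N: "\<And>x u. x \<in> A \<Longrightarrow> represents u x \<Longrightarrow>
      \<forall>\<^sub>F \<epsilon> in at_right 0. norm (u \<epsilon>) \<le> \<epsilon> powi (- int N)"
    using sharply_bounded_representatives[OF assms(2)] by blast
  obtain N' where N': "\<And>y v. y \<in> f ` A \<Longrightarrow> represents v y \<Longrightarrow>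
      \<forall>\<^sub>F \<epsilon> in at_right 0. norm (v \<epsilon>) \<le> \<epsilon> powi (- int N')"
    using sharply_bounded_representatives[OF assms(3)] by blast
  \<comment> \<open>The sets of the two nets may contain points that are too large to occur, for small \<open>\<epsilon>\<close>, in a
      representative of a point of \<open>A\<close> or of the graph; these are cut off.\<close>
  define D where "D \<epsilon> = {a \<in> A_net \<epsilon>. norm a \<le> \<epsilon> powi (- int N)}" for \<epsilon>
  define H where "H \<epsilon> = {p \<in> G \<epsilon>. norm (fst p) \<le> \<epsilon> powi (- int N) \<and>
    norm (snd p) \<le> \<epsilon> powi (- int N')}" for \<epsilon>
  have net_in_D: "\<exists>x\<in>A. represents u x" if "\<forall>\<^sub>F \<epsilon> in at_right 0. u \<epsilon> \<in> D \<epsilon>" for u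
  proof -
    have "represents u (gclass u)"
      using that by (intro represents_gclass moderateI) (auto simp: D_def elim: eventually_mono)
    moreover from this have "gclass u \<in> A"
      unfolding assms(4) mem_internal_set_iff
      using that by (intro exI[of _ u]) (auto simp: D_def elim: eventually_mono)
    ultimately show ?thesis by blast
  qed
  have net_in_H: "\<exists>x\<in>A. represents (\<lambda>\<epsilon>. fst (w \<epsilon>)) x \<and> represents (\<lambda>\<epsilon>. snd (w \<epsilon>)) (f x)"
    if "\<forall>\<^sub>F \<epsilon> in at_right 0. w \<epsilon> \<in> H \<epsilon>" for w
  proof -
    have "moderate (\<lambda>\<epsilon>. fst (w \<epsilon>))" "moderate (\<lambda>\<epsilon>. snd (w \<epsilon>))"
      using that by (auto simp: H_def elim: eventually_mono intro!: moderateI)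
    from represents_gpair[OF this[THEN represents_gclass]]
    obtain z where z: "represents w z" by auto
    moreover have "z \<in> internal_set G"
      unfolding mem_internal_set_iff
      using z that by (intro exI[of _ w]) (auto simp: H_def elim: eventually_mono)
    then obtain x where "x \<in> A" "z = gpair x (f x)" unfolding G[symmetric] by blast
    ultimately show ?thesis using represents_gpairD by blast
  qed
  have graph_net: "\<exists>w. (\<forall>\<^sub>F \<epsilon> in at_right 0. w \<epsilon> \<in> H \<epsilon>) \<and>
      represents (\<lambda>\<epsilon>. fst (w \<epsilon>)) x \<and> represents (\<lambda>\<epsilon>. snd (w \<epsilon>)) (f x)" if "x \<in> A" for x
  proof -
    have "gpair x (f x) \<in> internal_set G" using that G by blast
    then obtain w where w: "represents w (gpair x (f x))" "\<forall>\<^sub>F \<epsilon> in at_right 0. w \<epsilon> \<in> G \<epsilon>"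
      unfolding mem_internal_set_iff by blast
    note r = represents_gpairD[OF w(1)]
    have "\<forall>\<^sub>F \<epsilon> in at_right 0. w \<epsilon> \<in> H \<epsilon>"
      using w(2) N[OF that r(1)] N'[OF imageI[OF that] r(2)]
      by eventually_elim (simp add: H_def)
    with r show ?thesis by blast
  qed
  have D_eventually: "\<forall>\<^sub>F \<epsilon> in at_right 0. u \<epsilon> \<in> D \<epsilon>"
    if "x \<in> A" "represents u x" "\<forall>\<^sub>F \<epsilon> in at_right 0. u \<epsilon> \<in> A_net \<epsilon>" for x u
    using that(3) N[OF that(1,2)] by eventually_elim (simp add: D_def)
  obtain x0 where x0: "x0 \<in> A" using False by blast
  have H_ne: "\<forall>\<^sub>F \<epsilon> in at_right 0. H \<epsilon> \<noteq> {}"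
    using graph_net[OF x0] by (auto elim: eventually_mono)
  have D_ne: "\<forall>\<^sub>F \<epsilon> in at_right 0. D \<epsilon> \<noteq> {}"
  proof -
    obtain u where "represents u x0" "\<forall>\<^sub>F \<epsilon> in at_right 0. u \<epsilon> \<in> A_net \<epsilon>"
      using x0 unfolding assms(4) mem_internal_set_iff by blast
    from D_eventually[OF x0 this] show ?thesis by (auto elim: eventually_mono)
  qed
  have cont: "\<exists>m. \<forall>\<^sub>F \<epsilon> in at_right 0. \<forall>p\<in>H \<epsilon>. \<forall>p'\<in>H \<epsilon>.
      norm (fst p - fst p') \<le> \<epsilon> ^ m \<longrightarrow> norm (snd p - snd p') \<le> \<epsilon> ^ n" for n
  proof (rule functional_net_uniformly_continuous[OF H_ne])
    fix w w'
    assume w: "\<forall>\<^sub>F \<epsilon> in at_right 0. w \<epsilon> \<in> H \<epsilon>" "\<forall>\<^sub>F \<epsilon> in at_right 0. w' \<epsilon> \<in> H \<epsilon>"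
      and neg: "negligible_net (\<lambda>\<epsilon>. fst (w \<epsilon>) - fst (w' \<epsilon>))"
    obtain x where x: "represents (\<lambda>\<epsilon>. fst (w \<epsilon>)) x" "represents (\<lambda>\<epsilon>. snd (w \<epsilon>)) (f x)"
      using net_in_H[OF w(1)] by blast
    obtain x' where x': "represents (\<lambda>\<epsilon>. fst (w' \<epsilon>)) x'" "represents (\<lambda>\<epsilon>. snd (w' \<epsilon>)) (f x')"
      using net_in_H[OF w(2)] by blast
    have "x = x'" using represents_unique[OF represents_cong[OF x(1) neg] x'(1)] .
    then show "negligible_net (\<lambda>\<epsilon>. snd (w \<epsilon>) - snd (w' \<epsilon>))"
      using represents_same[OF x(2)] x'(2) by (simp add: negligible_net_iff)
  qed
  have dense: "\<forall>\<^sub>F \<epsilon> in at_right 0. \<forall>a\<in>D \<epsilon>. \<exists>c\<in>fst ` H \<epsilon>. norm (a - c) \<le> \<epsilon> ^ m" for m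
  proof (rule netwise_dense_imp_uniformly_dense[OF D_ne])
    fix u assume "\<forall>\<^sub>F \<epsilon> in at_right 0. u \<epsilon> \<in> D \<epsilon>"
    then obtain x where x: "x \<in> A" "represents u x" using net_in_D by blast
    obtain w where w: "\<forall>\<^sub>F \<epsilon> in at_right 0. w \<epsilon> \<in> H \<epsilon>" "represents (\<lambda>\<epsilon>. fst (w \<epsilon>)) x"
      using graph_net[OF x(1)] by blast
    show "\<exists>c. (\<forall>\<^sub>F \<epsilon> in at_right 0. c \<epsilon> \<in> fst ` H \<epsilon>) \<and> negligible_net (\<lambda>\<epsilon>. u \<epsilon> - c \<epsilon>)"
      using w(1) represents_same[OF x(2) w(2)]
      by (intro exI[of _ "\<lambda>\<epsilon>. fst (w \<epsilon>)"]) (auto simp: negligible_net_iff elim: eventually_mono)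
  qed
  have "bounded (D \<epsilon>)" for \<epsilon> by (auto simp: D_def bounded_iff)
  from smooth_net_near_relation[OF this cont dense]
  obtain F where F: "\<And>\<epsilon>. smooth_map (F \<epsilon>)" "\<And>k. \<forall>\<^sub>F \<epsilon> in at_right 0. \<forall>a\<in>D \<epsilon>. \<exists>p\<in>H \<epsilon>.
      norm (a - fst p) \<le> \<epsilon> ^ k \<and> norm (F \<epsilon> a - snd p) \<le> \<epsilon> ^ k" by blast
  have represented: "represents (\<lambda>\<epsilon>. F \<epsilon> (u \<epsilon>)) (f x)"
    if u: "x \<in> A" "represents u x" "\<forall>\<^sub>F \<epsilon> in at_right 0. u \<epsilon> \<in> A_net \<epsilon>" for x u
  proof -
    obtain w where w: "\<forall>\<^sub>F \<epsilon> in at_right 0. w \<epsilon> \<in> H \<epsilon>" "represents (\<lambda>\<epsilon>. fst (w \<epsilon>)) x"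
      "represents (\<lambda>\<epsilon>. snd (w \<epsilon>)) (f x)"
      using graph_net[OF u(1)] by blast
    have "negligible_net (\<lambda>\<epsilon>. snd (w \<epsilon>) - F \<epsilon> (u \<epsilon>))"
      unfolding negligible_net_iff
    proof
      fix n
      obtain m where m: "\<forall>\<^sub>F \<epsilon> in at_right 0. \<forall>p\<in>H \<epsilon>. \<forall>p'\<in>H \<epsilon>.
          norm (fst p - fst p') \<le> \<epsilon> ^ m \<longrightarrow> norm (snd p - snd p') \<le> \<epsilon> ^ Suc n"
        using cont by blast
      \<comment> \<open>\<open>p\<close> below is a point of the graph near \<open>u \<epsilon>\<close> whose value is near \<open>F \<epsilon> (u \<epsilon>)\<close>; as it is also
          near the point \<open>w \<epsilon>\<close> of the graph, so are the values of the two.\<close>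
      define k where "k = Suc (max m n)"
      show "\<forall>\<^sub>F \<epsilon> in at_right 0. norm (snd (w \<epsilon>) - F \<epsilon> (u \<epsilon>)) \<le> \<epsilon> ^ n"
        using m F(2)[of k] w(1) D_eventually[OF u] represents_same[OF w(2) u(2), of k]
          eventually_small[of "1/2", simplified]
      proof eventually_elim
        case (elim \<epsilon>)
        have e: "0 < \<epsilon>" "\<epsilon> \<le> 1/2" using elim(6) by auto
        obtain p where p: "p \<in> H \<epsilon>" "norm (u \<epsilon> - fst p) \<le> \<epsilon> ^ k" "norm (F \<epsilon> (u \<epsilon>) - snd p) \<le> \<epsilon> ^ k"
          using elim(2,4) by blast
        have half: "2 * \<epsilon> ^ Suc j \<le> \<epsilon> ^ j" for j
          using e by (simp add: mult_left_le_one_le)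
        have "norm (fst (w \<epsilon>) - fst p) \<le> 2 * \<epsilon> ^ k"
          using elim(5) p(2) norm_triangle_ineq[of "fst (w \<epsilon>) - u \<epsilon>" "u \<epsilon> - fst p"] by simp
        also have "\<dots> \<le> \<epsilon> ^ max m n" unfolding k_def by (rule half)
        also have "\<dots> \<le> \<epsilon> ^ m" using e by (intro power_decreasing) auto
        finally have "norm (snd (w \<epsilon>) - snd p) \<le> \<epsilon> ^ Suc n" using elim(1,3) p(1) by blast
        moreover have "\<epsilon> ^ k \<le> \<epsilon> ^ Suc n" using e by (intro power_decreasing) (auto simp: k_def)
        ultimately have "norm (snd (w \<epsilon>) - F \<epsilon> (u \<epsilon>)) \<le> 2 * \<epsilon> ^ Suc n"
          using p(3) norm_triangle_ineq4[of "snd (w \<epsilon>) - snd p" "F \<epsilon> (u \<epsilon>) - snd p"] by simp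
        also have "\<dots> \<le> \<epsilon> ^ n" by (rule half)
        finally show ?case .
      qed
    qed
    then show ?thesis by (rule represents_cong[OF w(3)])
  qed
  have "\<exists>m. \<forall>x\<in>A. \<forall>x'\<in>A. gnorm (x - x') \<le>\<^sub>g alpha_pow (int m) \<longrightarrow>
      gnorm (f x - f x') \<le>\<^sub>g alpha_pow (int n)" for n
  proof -
    obtain m where m: "\<forall>\<^sub>F \<epsilon> in at_right 0. \<forall>p\<in>H \<epsilon>. \<forall>p'\<in>H \<epsilon>.
        norm (fst p - fst p') \<le> \<epsilon> ^ m \<longrightarrow> norm (snd p - snd p') \<le> \<epsilon> ^ n"
      using cont by blast
    have "gnorm (f x - f x') \<le>\<^sub>g alpha_pow (int n)"
      if x: "x \<in> A" "x' \<in> A" and le: "gnorm (x - x') \<le>\<^sub>g alpha_pow (int (Suc m))" for x x'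
    proof -
      obtain w where w: "\<forall>\<^sub>F \<epsilon> in at_right 0. w \<epsilon> \<in> H \<epsilon>" "represents (\<lambda>\<epsilon>. fst (w \<epsilon>)) x"
        "represents (\<lambda>\<epsilon>. snd (w \<epsilon>)) (f x)"
        using graph_net[OF x(1)] by blast
      obtain w' where w': "\<forall>\<^sub>F \<epsilon> in at_right 0. w' \<epsilon> \<in> H \<epsilon>" "represents (\<lambda>\<epsilon>. fst (w' \<epsilon>)) x'"
        "represents (\<lambda>\<epsilon>. snd (w' \<epsilon>)) (f x')"
        using graph_net[OF x(2)] by blast
      have "\<forall>\<^sub>F \<epsilon> in at_right 0. norm (fst (w \<epsilon>) - fst (w' \<epsilon>)) \<le> \<epsilon> ^ m"
        using gnorm_le_alpha_powD[OF le represents_diff[OF w(2) w'(2)]] by simp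
      with m w(1) w'(1) have "\<forall>\<^sub>F \<epsilon> in at_right 0. norm (snd (w \<epsilon>) - snd (w' \<epsilon>)) \<le> \<epsilon> powi int n"
        by eventually_elim simp
      then show ?thesis by (rule gnorm_le_alpha_powI[OF represents_diff[OF w(3) w'(3)]])
    qed
    then show ?thesis by blast
  qed
  moreover have "smooth_on_set S (F \<epsilon>)" for S \<epsilon>
    using F(1) by (auto simp: smooth_on_set_def)
  moreover have "represents (\<lambda>\<epsilon>. F \<epsilon> (u \<epsilon>)) (f x)"
    if "x \<in> A" "represents u x" "\<forall>\<epsilon>\<in>{0<..<1}. u \<epsilon> \<in> A_net \<epsilon>" for x u
  proof (rule represented[OF that(1,2)])
    show "\<forall>\<^sub>F \<epsilon> in at_right 0. u \<epsilon> \<in> A_net \<epsilon>"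
      using eventually_at_right_real[of 0 1] that(3) by (auto elim: eventually_mono)
  qed
  ultimately show ?thesis by blast
qed

end
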